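(* Let $(T_n)_{n\in\mathbb{Z}}$ be the Tribonacci numbers. For every integer $m$ and every non-negative integer $k$, the following identities hold: $$\sum_{j=0}^{k} (-1)^j \binom{k}{j} 2^j\, T_{m-4k+3j} = (-1)^k T_m,$$ $$\sum_{j=0}^{k} \binom{k}{j} T_{m-3k+4j} = 2^k T_m,$$ $$\sum_{j=0}^{k} (-1)^j \binom{k}{j} 2^{-j}\, T_{m+3k+j} = 2^{-k} T_m.$$
   Context: The Tribonacci numbers are defined by $T_0=0$, $T_1=T_2=1$ and $T_m=T_{m-1}+T_{m-2}+T_{m-3}$ for $m\ge 3$. They are extended to negative subscripts by $T_{-m}=2T_{-m+3}-T_{-m+4}$ for $m\ge 1$; equivalently, $(T_n)_{n\in\mathbb{Z}}$ is the unique two-sided integer sequence with $T_0=0$, $T_1=T_2=1$ satisfying $T_n=T_{n-1}+T_{n-2}+T_{n-3}$ for all $n\in\mathbb{Z}$. *)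

theory Defs
  imports Complex_Main
begin

function tribonacci :: "int \<Rightarrow> int" where
  "tribonacci 0 = 0"
| "tribonacci 1 = 1"
| "tribonacci 2 = 1"
| "n \<ge> 3 \<Longrightarrow> tribonacci n = tribonacci (n - 1) + tribonacci (n - 2) + tribonacci (n - 3)"
| "n < 0 \<Longrightarrow> tribonacci n = 2 * tribonacci (n + 3) - tribonacci (n + 4)"
  by (atomize_elim, presburger) auto
termination
  by (relation "measure (\<lambda>n. if n \<ge> 0 then nat n else nat (4 - n))") auto

declare tribonacci.simps(4,5) [simp del]

lemma tribonacci_rec:
  "tribonacci n = tribonacci (n - 1) + tribonacci (n - 2) + tribonacci (n - 3)"
proof (cases "n \<ge> 3")
  case True
  then show ?thesis by (rule tribonacci.simps(4))
next
  case False
  then have "n \<le> 3" by simp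
  then show ?thesis
  proof (induction n rule: int_le_induct)
    case base
    show ?case by (rule tribonacci.simps(4)) simp
  next
    case (step i)
    then have "tribonacci (i - 4) = 2 * tribonacci (i - 4 + 3) - tribonacci (i - 4 + 4)"
      by (intro tribonacci.simps(5)) simp
    with step.IH show ?case by (simp add: algebra_simps del: tribonacci.simps)
  qed
qed

lemma tribonacci_unique:
  fixes S :: "int \<Rightarrow> int"
  assumes "S 0 = 0" "S 1 = 1" "S 2 = 1"
    and rec: "\<And>n. S n = S (n - 1) + S (n - 2) + S (n - 3)"
  shows "S = tribonacci"
proof
  fix n
  show "S n = tribonacci n"
  proof (induction n rule: tribonacci.induct)
    case (4 n)
    then show ?case using rec[of n] tribonacci.simps(4)[OF 4(1)] by simp
  next
    case (5 n)
    have "S n = 2 * S (n + 3) - S (n + 4)"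
      using rec[of "n + 3"] rec[of "n + 4"] by (simp add: algebra_simps)
    with 5 show ?case using tribonacci.simps(5)[OF 5(1)] by simp
  qed (use assms(1-3) in simp_all)
qed

end

theory Submission
  imports Defs
begin

text \<open>
  Let \<open>E\<close> be the shift operator \<open>(E S) n = S (n + 1)\<close> on two-sided sequences. The characteristic
  polynomial \<open>x ^ 3 - x ^ 2 - x - 1\<close> of the Tribonacci recurrence, multiplied by \<open>x - 1\<close>, is the
  trinomial \<open>x ^ 4 - 2 * x ^ 3 + 1\<close>, so \<open>E ^ 4 - 2 * E ^ 3 + 1\<close> annihilates \<open>tribonacci\<close>
  (lemma \<open>tribonacci_trinomial\<close>). Solving this relation for any one of its three terms shows that
  \<open>tribonacci\<close> is an eigenvector, with some eigenvalue \<open>c\<close>, of an operator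
  \<open>E ^ p * (1 + b * E ^ r)\<close>. It is then an eigenvector of the \<open>k\<close>-th power of that operator, with
  eigenvalue \<open>c ^ k\<close>, and the binomial expansion of that power (lemma \<open>binomial_shift_sum\<close>) gives one
  identity for each choice of the term.
\<close>

lemma sum_binomial_Suc:
  fixes f :: "nat \<Rightarrow> 'a :: comm_semiring_1"
  shows "(\<Sum>j=0..Suc k. of_nat (Suc k choose j) * f j) =
         (\<Sum>j=0..k. of_nat (k choose j) * (f j + f (Suc j)))"
proof -
  have "(\<Sum>j=0..Suc k. of_nat (Suc k choose j) * f j) =
        f 0 + (\<Sum>j=0..k. of_nat (k choose Suc j) * f (Suc j))
            + (\<Sum>j=0..k. of_nat (k choose j) * f (Suc j))"
    by (simp add: sum.atLeast0_atMost_Suc_shift sum.distrib algebra_simps del: sum.cl_ivl_Suc)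
  also have "f 0 + (\<Sum>j=0..k. of_nat (k choose Suc j) * f (Suc j)) =
             (\<Sum>j=0..Suc k. of_nat (k choose j) * f j)"
    by (simp add: sum.atLeast0_atMost_Suc_shift del: sum.cl_ivl_Suc)
  also have "\<dots> = (\<Sum>j=0..k. of_nat (k choose j) * f j)"
    by (simp add: binomial_eq_0)
  finally show ?thesis
    by (simp add: sum.distrib algebra_simps)
qed

text \<open>
  The sum is the value at \<open>n\<close> of \<open>(E ^ p * (1 + b * E ^ r)) ^ k\<close> applied to \<open>S\<close>, expanded by the
  binomial theorem. Splitting off one factor by Pascal's rule lets it act on \<open>S\<close> first, where it
  contributes the eigenvalue \<open>c\<close>.
\<close>

lemma binomial_shift_sum:
  fixes S :: "int \<Rightarrow> 'a :: comm_ring_1"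
  assumes eigen: "\<And>n. S (n + p) + b * S (n + p + r) = c * S n"
  shows "(\<Sum>j=0..k. of_nat (k choose j) * (b ^ j * S (n + p * int k + r * int j))) = c ^ k * S n"
proof (induction k)
  case 0
  show ?case by simp
next
  case (Suc k)
  let ?f = "\<lambda>j. b ^ j * S (n + p * int (Suc k) + r * int j)"
  have step: "?f j + ?f (Suc j) = c * (b ^ j * S (n + p * int k + r * int j))" for j
  proof -
    have "?f j + ?f (Suc j) =
          b ^ j * (S ((n + p * int k + r * int j) + p) + b * S ((n + p * int k + r * int j) + p + r))"
      by (simp add: algebra_simps)
    then show ?thesis
      by (simp only: eigen mult.left_commute)
  qed
  have "(\<Sum>j=0..Suc k. of_nat (Suc k choose j) * ?f j) =
        c * (\<Sum>j=0..k. of_nat (k choose j) * (b ^ j * S (n + p * int k + r * int j)))"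
    unfolding sum_binomial_Suc step by (simp add: sum_distrib_left mult.left_commute)
  then show ?case
    unfolding Suc.IH by (simp only: power_Suc mult.assoc)
qed

text \<open>
  This is the difference of the defining recurrences for the indices \<open>n + 4\<close> and \<open>n + 3\<close>.
\<close>

lemma tribonacci_trinomial:
  "tribonacci (n + 4) - 2 * tribonacci (n + 3) + tribonacci n = 0"
  using tribonacci_rec[of "n + 4"] tribonacci_rec[of "n + 3"] by (simp add: add.commute)

theorem theorem4:
  fixes m :: int and k :: nat
  shows "(\<Sum>j=0..k. (- 1) ^ j * int (k choose j) * 2 ^ j * tribonacci (m - 4 * int k + 3 * int j))
           = (- 1) ^ k * tribonacci m
       \<and> (\<Sum>j=0..k. int (k choose j) * tribonacci (m - 3 * int k + 4 * int j))
           = 2 ^ k * tribonacci m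
       \<and> (\<Sum>j=0..k. (- 1) ^ j * real (k choose j) * 2 powi (- int j)
             * real_of_int (tribonacci (m + 3 * int k + int j)))
           = 2 powi (- int k) * real_of_int (tribonacci m)"
proof (intro conjI)
  \<comment> \<open>the trinomial relation solved for its leading term\<close>
  have "tribonacci (n + - 4) + (- 2) * tribonacci (n + - 4 + 3) = (- 1) * tribonacci n" for n
    using tribonacci_trinomial[of "n - 4"] by simp
  from binomial_shift_sum[of tribonacci, OF this, of k m]
  show "(\<Sum>j=0..k. (- 1) ^ j * int (k choose j) * 2 ^ j * tribonacci (m - 4 * int k + 3 * int j))
          = (- 1) ^ k * tribonacci m"
    by (simp add: power_minus[of 2] mult_ac)
next
  \<comment> \<open>the trinomial relation solved for its middle term\<close>
  have "tribonacci (n + - 3) + 1 * tribonacci (n + - 3 + 4) = 2 * tribonacci n" for n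
    using tribonacci_trinomial[of "n - 3"] by simp
  from binomial_shift_sum[of tribonacci, OF this, of k m]
  show "(\<Sum>j=0..k. int (k choose j) * tribonacci (m - 3 * int k + 4 * int j))
          = 2 ^ k * tribonacci m"
    by simp
next
  let ?S = "\<lambda>n. real_of_int (tribonacci n)"
  \<comment> \<open>the trinomial relation solved for its trailing term, and halved so that the first shift
    has coefficient \<open>1\<close>\<close>
  have "?S (n + 3) + (- 1 / 2) * ?S (n + 3 + 1) = (1 / 2) * ?S n" for n
    using arg_cong[OF tribonacci_trinomial[of n], of real_of_int] by (simp add: add.commute)
  from binomial_shift_sum[of ?S, OF this, of k m]
  show "(\<Sum>j=0..k. (- 1) ^ j * real (k choose j) * 2 powi (- int j)
            * real_of_int (tribonacci (m + 3 * int k + int j)))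
          = 2 powi (- int k) * real_of_int (tribonacci m)"
    by (simp add: power_int_minus power_divide power_minus[of "1/2"] field_simps)
qed

end
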